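(* For a digraph $G$ the following properties are equivalent: 1. $G$ is a directed co-weakly quasi threshold graph. 2. $G\in\mathrm{Free}(\{D_1,\dots,D_8,\text{co-}Q_1,\dots,\text{co-}Q_7\})$.
   Context: Digraphs $G=(V,E)$ are finite with nonempty vertex set and $E\subseteq\{(u,v): u,v\in V,\ u\neq v\}$ (no loops, no multiple arcs; both $(u,v)$ and $(v,u)$ may be present). All classes are closed under isomorphism. For a set $F$ of digraphs, $\mathrm{Free}(F)$ is the class of all digraphs having no induced subdigraph isomorphic to a member of $F$. The complement $\text{co-}G$ of a digraph $G=(V,E)$ has vertex set $V$ and arc set $\{(u,v): u\ne v,\ (u,v)\notin E\}$. A bidirectional complete digraph has all arcs $(u,v)$, $u\neq v$. Operations on vertex-disjoint digraphs $G_1=(V_1,E_1)$, $G_2=(V_2,E_2)$: each result has vertex set $V_1\cup V_2$; $G_1\oplus G_2$ has arc set $E_1\cup E_2$; $G_1\otimes G_2$ has arc set $E_1\cup E_2\cup\{(u,v),(v,u):u\in V_1,v\in V_2\}$; $G_1\oslash G_2$ has arc set $E_1\cup E_2\cup\{(u,v):u\in V_1,v\in V_2\}$. The symbol $\bullet$ is a one-vertex digraph. Directed co-weakly quasi threshold graphs: the smallest class containing every bidirectional complete digraph, containing $G_1\otimes G_2$ whenever it contains $G_1,G_2$, and containing $G\oslash K$, $K\oslash G$, $G\oplus K$ whenever it contains $G$ and $K$ is a bidirectional complete digraph. Special digraphs: $\overleftrightarrow{K_2}$ has two vertices and both arcs between them; $\overrightarrow{P_2}$ has two vertices and exactly one arc.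 $D_1$: vertices $a,b,c$, arcs $(a,b),(b,c)$. $D_2$: vertices $a,b,c$, arcs $(a,b),(b,c),(c,b)$. $D_3$: vertices $a,b,c$, arcs $(b,a),(b,c),(c,b)$. $D_4$: vertices $a,b,c$, arcs $(a,b),(b,c),(a,c),(c,a)$. $D_5$: the directed cycle $(a,b),(b,c),(c,a)$. $D_6$: vertices $a,b,c,d$, arcs $(b,a),(b,c),(d,c)$ and both arcs between $a,c$, between $a,d$, and between $b,d$. $D_7$: vertices $a,b,c,d$, both arcs between $a,b$, between $b,c$, and between $c,d$. $D_8$: vertices $a,b,c,d$, arcs $(a,b),(c,b),(c,d)$. Let $Y_1=\overleftrightarrow{K_2}$, $Y_2=\overrightarrow{P_2}$, $Y_3=\overleftrightarrow{K_2}\oplus\bullet$, $Y_4=\overrightarrow{P_2}\oplus\bullet$. Then (with vertex-disjoint copies) $Q_1=Y_2\otimes Y_2$, $Q_2=Y_1\oslash Y_1$, $Q_3=Y_3\otimes Y_3$, $Q_4=Y_2\otimes Y_3$, $Q_5=Y_1\oslash Y_4$, $Q_6=Y_4\oslash Y_1$, $Q_7=Y_4\oslash Y_4$. *)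

theory Defs
  imports "Graph_Theory.Graph_Theory"
begin

text \<open>
  A digraph is a \<open>pair_digraph\<close> (finite, no loops, arcs are pairs of vertices) with nonempty vertex
  set; the library locale by itself admits the empty digraph.
\<close>

definition nonempty_digraph :: "'a pair_pre_digraph \<Rightarrow> bool" where
  "nonempty_digraph G \<longleftrightarrow> pair_digraph G \<and> pverts G \<noteq> {}"

definition complement :: "'a pair_pre_digraph \<Rightarrow> 'a pair_pre_digraph" where
  "complement G = \<lparr> pverts = pverts G,
     parcs = {(u, v). u \<in> pverts G \<and> v \<in> pverts G \<and> u \<noteq> v \<and> (u, v) \<notin> parcs G} \<rparr>"

definition bidirectional_complete :: "'a pair_pre_digraph \<Rightarrow> bool" where
  "bidirectional_complete K \<longleftrightarrow> (\<exists>n\<ge>1. complete_digraph n (with_proj K))"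

text \<open>The three operations are meaningful for vertex-disjoint arguments only.\<close>

definition disjoint_union ::
  "'a pair_pre_digraph \<Rightarrow> 'a pair_pre_digraph \<Rightarrow> 'a pair_pre_digraph" (infixl "\<oplus>\<^sub>d" 65) where
  "G1 \<oplus>\<^sub>d G2 = \<lparr> pverts = pverts G1 \<union> pverts G2, parcs = parcs G1 \<union> parcs G2 \<rparr>"

definition series_composition ::
  "'a pair_pre_digraph \<Rightarrow> 'a pair_pre_digraph \<Rightarrow> 'a pair_pre_digraph" (infixl "\<otimes>\<^sub>d" 65) where
  "G1 \<otimes>\<^sub>d G2 = \<lparr> pverts = pverts G1 \<union> pverts G2,
     parcs = parcs G1 \<union> parcs G2 \<union> pverts G1 \<times> pverts G2 \<union> pverts G2 \<times> pverts G1 \<rparr>"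

definition order_composition ::
  "'a pair_pre_digraph \<Rightarrow> 'a pair_pre_digraph \<Rightarrow> 'a pair_pre_digraph" (infixl "\<oslash>\<^sub>d" 65) where
  "G1 \<oslash>\<^sub>d G2 = \<lparr> pverts = pverts G1 \<union> pverts G2,
     parcs = parcs G1 \<union> parcs G2 \<union> pverts G1 \<times> pverts G2 \<rparr>"

definition vertex_disjoint :: "'a pair_pre_digraph \<Rightarrow> 'a pair_pre_digraph \<Rightarrow> bool" where
  "vertex_disjoint G1 G2 \<longleftrightarrow> pverts G1 \<inter> pverts G2 = {}"

text \<open>
  The class is formed on one vertex type at a time. No isomorphism rule is needed: all rules are
  invariant under relabelling of vertices, and the operands of each rule are induced subdigraphs of
  its result, so that a member never requires vertices other than its own.
\<close>

inductive directed_co_wqt :: "'a pair_pre_digraph \<Rightarrow> bool" where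
  complete: "bidirectional_complete K \<Longrightarrow> directed_co_wqt K"
| series: "\<lbrakk>directed_co_wqt G1; directed_co_wqt G2; vertex_disjoint G1 G2\<rbrakk>
    \<Longrightarrow> directed_co_wqt (G1 \<otimes>\<^sub>d G2)"
| order_right: "\<lbrakk>directed_co_wqt G; bidirectional_complete K; vertex_disjoint G K\<rbrakk>
    \<Longrightarrow> directed_co_wqt (G \<oslash>\<^sub>d K)"
| order_left: "\<lbrakk>directed_co_wqt G; bidirectional_complete K; vertex_disjoint K G\<rbrakk>
    \<Longrightarrow> directed_co_wqt (K \<oslash>\<^sub>d G)"
| union: "\<lbrakk>directed_co_wqt G; bidirectional_complete K; vertex_disjoint G K\<rbrakk>
    \<Longrightarrow> directed_co_wqt (G \<oplus>\<^sub>d K)"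

definition Free :: "'b pair_pre_digraph set \<Rightarrow> 'a pair_pre_digraph set" where
  "Free F = {G. nonempty_digraph G \<and>
     \<not> (\<exists>X \<in> F. \<exists>H. induced_subgraph (with_proj H) (with_proj G)
          \<and> digraph_iso (with_proj H) (with_proj X))}"

definition both_arcs :: "'a \<Rightarrow> 'a \<Rightarrow> 'a rel" where
  "both_arcs u v = {(u, v), (v, u)}"

text \<open>In the special digraphs the vertices \<open>a, b, c, d\<close> are \<open>0, 1, 2, 3\<close>.\<close>

definition D1 :: "nat pair_pre_digraph" where
  "D1 = \<lparr> pverts = {0, 1, 2}, parcs = {(0, 1), (1, 2)} \<rparr>"

definition D2 :: "nat pair_pre_digraph" where
  "D2 = \<lparr> pverts = {0, 1, 2}, parcs = {(0, 1), (1, 2), (2, 1)} \<rparr>"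

definition D3 :: "nat pair_pre_digraph" where
  "D3 = \<lparr> pverts = {0, 1, 2}, parcs = {(1, 0), (1, 2), (2, 1)} \<rparr>"

definition D4 :: "nat pair_pre_digraph" where
  "D4 = \<lparr> pverts = {0, 1, 2}, parcs = {(0, 1), (1, 2), (0, 2), (2, 0)} \<rparr>"

definition D5 :: "nat pair_pre_digraph" where
  "D5 = \<lparr> pverts = {0, 1, 2}, parcs = {(0, 1), (1, 2), (2, 0)} \<rparr>"

definition D6 :: "nat pair_pre_digraph" where
  "D6 = \<lparr> pverts = {0, 1, 2, 3},
     parcs = {(1, 0), (1, 2), (3, 2)} \<union> both_arcs 0 2 \<union> both_arcs 0 3 \<union> both_arcs 1 3 \<rparr>"

definition D7 :: "nat pair_pre_digraph" where
  "D7 = \<lparr> pverts = {0, 1, 2, 3}, parcs = both_arcs 0 1 \<union> both_arcs 1 2 \<union> both_arcs 2 3 \<rparr>"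

definition D8 :: "nat pair_pre_digraph" where
  "D8 = \<lparr> pverts = {0, 1, 2, 3}, parcs = {(0, 1), (2, 1), (2, 3)} \<rparr>"

text \<open>
  The building blocks take their vertices as arguments, so that vertex-disjoint copies are obtained
  by choosing distinct arguments.
\<close>

definition one_vertex :: "'a \<Rightarrow> 'a pair_pre_digraph" where
  "one_vertex v = \<lparr> pverts = {v}, parcs = {} \<rparr>"

definition Y1 :: "'a \<Rightarrow> 'a \<Rightarrow> 'a pair_pre_digraph" where
  "Y1 u v = \<lparr> pverts = {u, v}, parcs = both_arcs u v \<rparr>"

definition Y2 :: "'a \<Rightarrow> 'a \<Rightarrow> 'a pair_pre_digraph" where
  "Y2 u v = \<lparr> pverts = {u, v}, parcs = {(u, v)} \<rparr>"

definition Y3 :: "'a \<Rightarrow> 'a \<Rightarrow> 'a \<Rightarrow> 'a pair_pre_digraph" where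
  "Y3 u v w = Y1 u v \<oplus>\<^sub>d one_vertex w"

definition Y4 :: "'a \<Rightarrow> 'a \<Rightarrow> 'a \<Rightarrow> 'a pair_pre_digraph" where
  "Y4 u v w = Y2 u v \<oplus>\<^sub>d one_vertex w"

definition Q1 :: "nat pair_pre_digraph" where "Q1 = Y2 0 1 \<otimes>\<^sub>d Y2 2 3"
definition Q2 :: "nat pair_pre_digraph" where "Q2 = Y1 0 1 \<oslash>\<^sub>d Y1 2 3"
definition Q3 :: "nat pair_pre_digraph" where "Q3 = Y3 0 1 2 \<otimes>\<^sub>d Y3 3 4 5"
definition Q4 :: "nat pair_pre_digraph" where "Q4 = Y2 0 1 \<otimes>\<^sub>d Y3 2 3 4"
definition Q5 :: "nat pair_pre_digraph" where "Q5 = Y1 0 1 \<oslash>\<^sub>d Y4 2 3 4"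
definition Q6 :: "nat pair_pre_digraph" where "Q6 = Y4 0 1 2 \<oslash>\<^sub>d Y1 3 4"
definition Q7 :: "nat pair_pre_digraph" where "Q7 = Y4 0 1 2 \<oslash>\<^sub>d Y4 3 4 5"

end

theory Submission
  imports Defs
begin

text \<open>
  Colour each pair of vertices by the number of arcs between them. The digraphs \<open>D\<^sub>1, \<dots>, D\<^sub>5\<close> say
  that no triangle is rainbow and that the one-way arcs form a strict order; \<open>D\<^sub>6, D\<^sub>7, D\<^sub>8\<close> exclude
  two-coloured copies of \<open>P\<^sub>4\<close>. By an argument in the style of Gallai and Seinsche every vertex set
  with at least two elements then has a cut whose cross pairs all have one colour, and a cut of
  one-way arcs can be turned into one in which they all point the same way. In a cut without arcs or
  with one-way arcs, one end of the finest such decomposition must be complete, since otherwise both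
  ends contain a small pattern and together these form one of the \<open>co-Q\<^sub>i\<close>.

  Conversely, none of the forbidden digraphs splits along a cut of the kind produced by the operations,
  so a copy in a composed digraph lies in one of the operands.
\<close>

section \<open>Monochromatic cuts\<close>

text \<open>By induction, removing a vertex \<open>v\<close>: the rest has a cut \<open>A\<close>,
  \<open>B\<close> of colour \<open>c\<close>. If adding \<open>v\<close> destroys every cut, then
  \<open>v\<close> meets neither side in colour \<open>c\<close>. The triangles \<open>v\<close>,
  \<open>a\<close>, \<open>b\<close> now force a single colour on all pairs at \<open>v\<close>, so
  \<open>{v}\<close> is one side of a cut, a contradiction.\<close>

lemma monochromatic_cut:
  fixes col :: "'a \<Rightarrow> 'a \<Rightarrow> 'c"
  assumes "finite V" "2 \<le> card V"
    and sym: "\<And>x y. col x y = col y x"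
    and "\<And>x y z. \<lbrakk>{x, y, z} \<subseteq> V; distinct [x, y, z]\<rbrakk> \<Longrightarrow> \<not> distinct [col x y, col y z, col x z]"
    and "\<And>w x y z c d. \<lbrakk>{w, x, y, z} \<subseteq> V; distinct [w, x, y, z]; c \<noteq> d;
      col w x = d; col x y = d; col y z = d; col w y = c; col w z = c; col x z = c\<rbrakk> \<Longrightarrow> False"
  shows "\<exists>A B c. A \<noteq> {} \<and> B \<noteq> {} \<and> A \<inter> B = {} \<and> A \<union> B = V \<and> (\<forall>a\<in>A. \<forall>b\<in>B. col a b = c)"
  using assms(1,2,4,5)
proof (induction V rule: finite_induct)
  case empty
  then show ?case by simp
next
  case (insert v W)
  note rainbow = insert.prems(2) and P4 = insert.prems(3)
  have split: ?case if "X \<noteq> {}" "X \<subset> insert v W" "\<And>x y. x \<in> X \<Longrightarrow> y \<in> insert v W - X \<Longrightarrow> col x y = c"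
    for X c
    using that by (intro exI[of _ X] exI[of _ "insert v W - X"] exI[of _ c]) auto
  show ?case
  proof (cases "2 \<le> card W")
    case False
    with insert.hyps insert.prems(1) have "card W = 1" by simp
    then obtain w where "W = {w}" by (auto simp: card_1_singleton_iff)
    with insert.hyps show ?thesis by (intro split[of "{v}" "col v w"]) auto
  next
    case True
    have "\<exists>A B c. A \<noteq> {} \<and> B \<noteq> {} \<and> A \<inter> B = {} \<and> A \<union> B = W \<and> (\<forall>a\<in>A. \<forall>b\<in>B. col a b = c)"
    proof (rule insert.IH[OF True])
      show "\<not> distinct [col x y, col y z, col x z]" if "{x, y, z} \<subseteq> W" "distinct [x, y, z]" for x y z
        using that by (intro rainbow) auto
      show False if "{w, x, y, z} \<subseteq> W" "distinct [w, x, y, z]" "c \<noteq> d" "col w x = d" "col x y = d"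
        "col y z = d" "col w y = c" "col w z = c" "col x z = c" for w x y z c d
        using that by (intro P4[of w x y z c d]) auto
    qed
    then obtain A B c where AB: "A \<noteq> {}" "B \<noteq> {}" "A \<inter> B = {}" "A \<union> B = W"
      and cross: "\<And>a b. a \<in> A \<Longrightarrow> b \<in> B \<Longrightarrow> col a b = c" by blast
    have v: "v \<notin> A" "v \<notin> B" using AB insert.hyps by auto
    show ?thesis
    proof (rule ccontr)
      assume none: "\<not> ?thesis"
      have no_split: False
        if "X \<noteq> {}" "X \<subset> insert v W" "\<And>x y. x \<in> X \<Longrightarrow> y \<in> insert v W - X \<Longrightarrow> col x y = c" for X c
        using none split[OF that] by blast
      have same: "col v a = col v b" if "a \<in> A" "b \<in> B" "col v a \<noteq> c" "col v b \<noteq> c" for a b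
        using rainbow[of v a b] cross[of a b] AB v that by auto
      text \<open>If \<open>v\<close> meets one side both in colour \<open>c\<close> and in other colours, then cutting off the
        \<open>c\<close>-neighbours on that side fails because of an edge \<open>x y\<close>, and \<open>x, y, v, z\<close> is a
        two-coloured \<open>P\<^sub>4\<close> for any \<open>z\<close> on the other side.\<close>
      have side: "\<forall>x\<in>X. col v x \<noteq> c"
        if XY: "X \<noteq> {}" "Y \<noteq> {}" "X \<inter> Y = {}" "X \<union> Y = W" "\<And>x y. x \<in> X \<Longrightarrow> y \<in> Y \<Longrightarrow> col x y = c"
          and same: "\<And>x y. \<lbrakk>x \<in> X; y \<in> Y; col v x \<noteq> c; col v y \<noteq> c\<rbrakk> \<Longrightarrow> col v x = col v y"
        for X Y
      proof (rule ccontr)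
        define Z where "Z = {x\<in>X. col v x = c}"
        assume "\<not> ?thesis"
        then have "Z \<noteq> {}" by (auto simp: Z_def)
        \<comment> \<open>Otherwise \<open>Y\<close> would meet \<open>v\<close> as well as
          \<open>X\<close> in colour \<open>c\<close> only, and would be one side of a cut.\<close>
        have "\<exists>z\<in>Y. col v z \<noteq> c"
        proof (rule ccontr)
          assume "\<not> ?thesis"
          with XY v AB have "Y \<subset> insert v W" "\<And>x y. x \<in> Y \<Longrightarrow> y \<in> insert v W - Y \<Longrightarrow> col y x = c"
            by auto
          with XY(2) show False by (intro no_split[of Y c]) (auto simp: sym)
        qed
        then obtain z where z: "z \<in> Y" "col v z \<noteq> c" by blast
        have "\<exists>x\<in>Z. \<exists>y\<in>X - Z. col x y \<noteq> c"
        proof (rule ccontr)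
          assume *: "\<not> ?thesis"
          have "col x y = c" if "x \<in> Z" "y \<in> insert v W - Z" for x y
          proof -
            from that have x: "x \<in> X" "col v x = c" by (auto simp: Z_def)
            from that XY(4) consider "y = v" | "y \<in> X - Z" | "y \<in> Y" by blast
            then show ?thesis
            proof cases
              case 1
              with x show ?thesis by (simp only: sym[of x v])
            next
              case 2
              with * that(1) show ?thesis by blast
            next
              case 3
              with XY(5) x show ?thesis by blast
            qed
          qed
          moreover have "Z \<subset> insert v W" using XY v AB by (auto simp: Z_def)
          ultimately show False using \<open>Z \<noteq> {}\<close> by (intro no_split[of Z c])
        qed
        then obtain x y where xy: "x \<in> X" "col v x = c" "y \<in> X" "col v y \<noteq> c" "col x y \<noteq> c"
          by (auto simp: Z_def)
        have d: "{x, y, v, z} \<subseteq> insert v W" "distinct [x, y, v, z]"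
          using XY(3,4) AB v xy z by auto
        have "col x y = col v y"
          using rainbow[of v x y] d xy by auto
        moreover have "col v y = col v z" using same xy z by blast
        ultimately show False
          using P4[OF d, of c "col v y"] xy z XY(5) sym by (metis (full_types))
      qed
      have A: "\<forall>x\<in>A. col v x \<noteq> c"
        using AB cross same by (intro side[of A B]) auto
      have B: "\<forall>x\<in>B. col v x \<noteq> c"
      proof (rule side[of B A])
        show "col x y = c" if "x \<in> B" "y \<in> A" for x y
          using cross[OF that(2,1)] by (simp only: sym[of x y])
        show "col v x = col v y" if "x \<in> B" "y \<in> A" "col v x \<noteq> c" "col v y \<noteq> c" for x y
          using same[of y x] that by simp
      qed (use AB in auto)
      obtain a b where ab: "a \<in> A" "b \<in> B" using AB by blast
      have "col v w = col v a" if "w \<in> W" for w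
        using that AB A B same ab by (metis UnE)
      then show False
        using insert.hyps AB by (intro no_split[of "{v}" "col v a"]) auto
    qed
  qed
qed

section \<open>Induced copies\<close>

text \<open>An induced copy is given by an injection instead of a subdigraph with an isomorphism;
  pattern and host may have different vertex types.\<close>

definition embeds :: "'b pair_pre_digraph \<Rightarrow> 'a pair_pre_digraph \<Rightarrow> bool" where
  "embeds X G \<longleftrightarrow> (\<exists>f. inj_on f (pverts X) \<and> f ` pverts X \<subseteq> pverts G \<and>
     (\<forall>u\<in>pverts X. \<forall>v\<in>pverts X. (u, v) \<in> parcs X \<longleftrightarrow> (f u, f v) \<in> parcs G))"

lemma embeds_listI:
  assumes "distinct xs" "set xs \<subseteq> pverts G" "pverts X = {0..<length xs}"
    and "\<forall>i<length xs. \<forall>j<length xs. (i, j) \<in> parcs X \<longleftrightarrow> (xs ! i, xs ! j) \<in> parcs G"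
  shows "embeds X G"
  unfolding embeds_def using assms
  by (intro exI[of _ "(!) xs"]) (auto simp: inj_on_def nth_eq_iff_index_eq)

text \<open>An embedding is the inverse of the vertex part of an isomorphism, and the copy lives on
  its image. Well-formedness of \<open>X\<close> puts the ends of each arc among its vertices, so
  that each arc comes from an arc of the copy.\<close>

lemma induced_iso_iff_embeds:
  assumes G: "pair_digraph G" and X: "pair_wf_digraph X"
  shows "(\<exists>H. induced_subgraph (with_proj H) (with_proj G) \<and> digraph_iso (with_proj H) (with_proj X))
    \<longleftrightarrow> embeds X G"
proof -
  interpret G: pair_digraph G by (rule G)
  interpret X: pair_wf_digraph X by (rule X)
  show ?thesis
  proof
    assume "\<exists>H. induced_subgraph (with_proj H) (with_proj G) \<and> digraph_iso (with_proj H) (with_proj X)"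
    then obtain H h where ind: "induced_subgraph (with_proj H) (with_proj G)"
      and h: "pre_digraph.digraph_isomorphism (with_proj H) h" "with_proj X = app_iso h (with_proj H)"
      by (auto simp: digraph_iso_def)
    define g where "g = iso_verts h"
    from ind have H: "pverts H \<subseteq> pverts G" "wf_digraph (with_proj H)"
      "parcs H = {e \<in> parcs G. fst e \<in> pverts H \<and> snd e \<in> pverts H}"
      by (auto simp: induced_subgraph_def subgraph_def)
    have VX: "pverts X = g ` pverts H" and AX: "parcs X = iso_arcs h ` parcs H"
      and ht: "iso_tail h = fst" "iso_head h = snd"
      using h(2) by (simp_all add: app_iso_def with_proj_def g_def)
    \<comment> \<open>The target is again a \<open>with_proj\<close>, so its tail and head maps are
      projections and the image of an arc is determined by the images of its ends.\<close>
    have arcs: "iso_arcs h e = (g (fst e), g (snd e))" if "e \<in> parcs H" for e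
      using h(1) that by (auto simp: pre_digraph.digraph_isomorphism_def ht g_def prod_eq_iff)
    have inj: "inj_on g (pverts H)"
      using h(1) by (auto simp: pre_digraph.digraph_isomorphism_def g_def)
    define f where "f = the_inv_into (pverts H) g"
    have fg: "f (g u) = u" if "u \<in> pverts H" for u
      using inj that by (simp add: f_def the_inv_into_f_f)
    have "(g u, g v) \<in> parcs X \<longleftrightarrow> (u, v) \<in> parcs G" if "u \<in> pverts H" "v \<in> pverts H" for u v
    proof
      assume "(g u, g v) \<in> parcs X"
      then obtain e where e: "e \<in> parcs H" "g u = g (fst e)" "g v = g (snd e)"
        using AX arcs by auto
      then have "fst e \<in> pverts H" "snd e \<in> pverts H" using H(3) by auto
      then have "u = fst e" "v = snd e" using e inj that by (auto dest: inj_onD)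
      then show "(u, v) \<in> parcs G" using e H(3) by auto
    next
      assume "(u, v) \<in> parcs G"
      then have "(u, v) \<in> parcs H" using H(3) that by auto
      from imageI[OF this, of "iso_arcs h"] arcs[OF this] show "(g u, g v) \<in> parcs X" using AX by simp
    qed
    then show "embeds X G"
      unfolding embeds_def using H(1)
      by (intro exI[of _ f]) (auto simp: VX fg inj_on_def)
  next
    assume "embeds X G"
    then obtain f where inj: "inj_on f (pverts X)" and ran: "f ` pverts X \<subseteq> pverts G"
      and arcs: "\<And>u v. \<lbrakk>u \<in> pverts X; v \<in> pverts X\<rbrakk> \<Longrightarrow> (u, v) \<in> parcs X \<longleftrightarrow> (f u, f v) \<in> parcs G"
      unfolding embeds_def by blast
    define g where "g = the_inv_into (pverts X) f"
    have gf: "g (f u) = u" if "u \<in> pverts X" for u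
      using inj that by (simp add: g_def the_inv_into_f_f)
    define H where "H = \<lparr>pverts = f ` pverts X, parcs = parcs G \<inter> f ` pverts X \<times> f ` pverts X\<rparr>"
    have wfH: "wf_digraph (with_proj H)"
      by unfold_locales (auto simp: H_def)
    have "induced_subgraph (with_proj H) (with_proj G)"
      unfolding induced_subgraph_def subgraph_def using wfH ran
      by (auto simp: H_def G.wf_digraph)
    moreover have "pre_digraph.digraph_isomorphism (with_proj H)
        \<lparr>iso_verts = g, iso_arcs = map_prod g g, iso_head = snd, iso_tail = fst\<rparr>"
      unfolding pre_digraph.digraph_isomorphism_def using wfH
      by (auto simp: H_def inj_on_def gf)
    moreover have "with_proj X = app_iso
        \<lparr>iso_verts = g, iso_arcs = map_prod g g, iso_head = snd, iso_tail = fst\<rparr> (with_proj H)"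
    proof -
      have "map_prod g g ` parcs H = parcs X"
      proof (intro equalityI subsetI)
        fix e assume "e \<in> parcs X"
        moreover obtain u v where "e = (u, v)" by (cases e)
        ultimately have uv: "(u, v) \<in> parcs X" "u \<in> pverts X" "v \<in> pverts X" "e = (u, v)"
          using X.wellformed' by auto
        then have "(f u, f v) \<in> parcs H" using arcs by (auto simp: H_def)
        from imageI[OF this, of "map_prod g g"] show "e \<in> map_prod g g ` parcs H"
          using uv gf by simp
      qed (auto simp: H_def gf arcs)
      moreover have "g ` pverts H = pverts X" by (auto simp: H_def gf image_image)
      ultimately show ?thesis by (simp add: app_iso_def with_proj_def)
    qed
    ultimately show "\<exists>H. induced_subgraph (with_proj H) (with_proj G) \<and> digraph_iso (with_proj H) (with_proj X)"
      unfolding digraph_iso_def by blast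
  qed
qed

lemma Free_iff_not_embeds:
  assumes "nonempty_digraph G" and wf: "\<And>X. X \<in> F \<Longrightarrow> pair_wf_digraph X"
  shows "G \<in> Free F \<longleftrightarrow> (\<forall>X\<in>F. \<not> embeds X G)"
proof -
  have "pair_digraph G" using assms(1) by (simp add: nonempty_digraph_def)
  from induced_iso_iff_embeds[OF this wf] show ?thesis
    unfolding Free_def using assms(1) by auto
qed

section \<open>Cuts of directed co-weakly quasi threshold graphs\<close>

definition complete_on :: "'a rel \<Rightarrow> 'a set \<Rightarrow> bool" where
  "complete_on E A \<longleftrightarrow> (\<forall>u\<in>A. \<forall>v\<in>A. u \<noteq> v \<longrightarrow> (u, v) \<in> E)"

text \<open>The alternatives mirror the series, order and union rules. The pair \<open>A\<close>,
  \<open>B\<close> is ordered: one-way arcs run from \<open>A\<close> to \<open>B\<close>, and in a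
  cut without arcs the complete part comes second.\<close>

definition wqt_cut :: "'a rel \<Rightarrow> 'a set \<Rightarrow> 'a set \<Rightarrow> bool" where
  "wqt_cut E A B \<longleftrightarrow>
     (\<forall>a\<in>A. \<forall>b\<in>B. (a, b) \<in> E \<and> (b, a) \<in> E) \<or>
     (\<forall>a\<in>A. \<forall>b\<in>B. (a, b) \<in> E \<and> (b, a) \<notin> E) \<and> (complete_on E A \<or> complete_on E B) \<or>
     (\<forall>a\<in>A. \<forall>b\<in>B. (a, b) \<notin> E \<and> (b, a) \<notin> E) \<and> complete_on E B"

definition wqt_separable :: "'a pair_pre_digraph \<Rightarrow> bool" where
  "wqt_separable X \<longleftrightarrow> (\<exists>A B. A \<noteq> {} \<and> B \<noteq> {} \<and> A \<inter> B = {} \<and> A \<union> B = pverts X \<and> wqt_cut (parcs X) A B)"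

lemma bidirectional_complete_iff:
  "bidirectional_complete K \<longleftrightarrow> finite (pverts K) \<and> pverts K \<noteq> {} \<and>
     parcs K = {(u, v). u \<in> pverts K \<and> v \<in> pverts K \<and> u \<noteq> v}"
  unfolding bidirectional_complete_def complete_digraph_pair_def
  by (auto simp: Suc_le_eq card_gt_0_iff)


lemma directed_co_wqt_arcs:
  assumes "directed_co_wqt G"
  shows "parcs G \<subseteq> pverts G \<times> pverts G"
  using assms
  by (induction rule: directed_co_wqt.induct)
    (auto simp: bidirectional_complete_iff disjoint_union_def series_composition_def order_composition_def)

text \<open>The cut pulls back along the embedding, and since \<open>f\<close> is injective, so does
  completeness of a part. As \<open>X\<close> is not separable, one of the two preimages is empty
  and the copy lies in a single operand.\<close>

lemma embeds_cut:
  assumes emb: "embeds X G" and X: "\<not> wqt_separable X"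
    and V: "pverts G = pverts G1 \<union> pverts G2" "pverts G1 \<inter> pverts G2 = {}"
    and E: "parcs G1 = parcs G \<inter> pverts G1 \<times> pverts G1" "parcs G2 = parcs G \<inter> pverts G2 \<times> pverts G2"
    and cut: "wqt_cut (parcs G) (pverts G1) (pverts G2)"
  shows "embeds X G1 \<or> embeds X G2"
proof -
  obtain f where inj: "inj_on f (pverts X)" and ran: "f ` pverts X \<subseteq> pverts G"
    and arcs: "\<And>u v. \<lbrakk>u \<in> pverts X; v \<in> pverts X\<rbrakk> \<Longrightarrow> (u, v) \<in> parcs X \<longleftrightarrow> (f u, f v) \<in> parcs G"
    using emb unfolding embeds_def by blast
  define A where "A = {u \<in> pverts X. f u \<in> pverts G1}"
  define B where "B = {u \<in> pverts X. f u \<in> pverts G2}"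
  have AB: "A \<inter> B = {}" "A \<union> B = pverts X" using V ran by (auto simp: A_def B_def)
  have complete: "complete_on (parcs X) {u \<in> pverts X. f u \<in> W}" if "complete_on (parcs G) W" for W
    using that inj arcs by (auto simp: complete_on_def inj_on_def)
  have "wqt_cut (parcs X) A B"
    using cut complete[of "pverts G1"] complete[of "pverts G2"] arcs
    unfolding wqt_cut_def A_def B_def by (elim disjE) auto
  with X AB consider "A = {}" | "B = {}" unfolding wqt_separable_def by blast
  then show ?thesis
  proof cases
    case 1
    then have "f ` pverts X \<subseteq> pverts G2" using AB by (auto simp: B_def)
    then show ?thesis
      unfolding embeds_def using inj arcs E by (intro disjI2 exI[of _ f]) auto
  next
    case 2
    then have "f ` pverts X \<subseteq> pverts G1" using AB by (auto simp: A_def)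
    then show ?thesis
      unfolding embeds_def using inj arcs E by (intro disjI1 exI[of _ f]) auto
  qed
qed

lemma bidirectional_complete_not_embeds:
  assumes "bidirectional_complete K" "\<not> complete_on (parcs X) (pverts X)"
  shows "\<not> embeds X K"
proof
  assume "embeds X K"
  then obtain f where f: "inj_on f (pverts X)" "f ` pverts X \<subseteq> pverts K"
    "\<And>u v. \<lbrakk>u \<in> pverts X; v \<in> pverts X\<rbrakk> \<Longrightarrow> (u, v) \<in> parcs X \<longleftrightarrow> (f u, f v) \<in> parcs K"
    unfolding embeds_def by blast
  then have "complete_on (parcs X) (pverts X)"
    using assms(1) by (auto simp: complete_on_def bidirectional_complete_iff image_subset_iff inj_on_eq_iff)
  with assms(2) show False by simp
qed

text \<open>Each operation produces a \<open>wqt_cut\<close>, so \<open>embeds_cut\<close> passes a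
  copy down to an operand. Incompleteness of \<open>X\<close> excludes copies in the complete
  digraphs at which this ends.\<close>

lemma directed_co_wqt_not_embeds:
  assumes "directed_co_wqt G" and X: "\<not> wqt_separable X" "\<not> complete_on (parcs X) (pverts X)"
  shows "\<not> embeds X G"
  using assms(1)
proof (induction rule: directed_co_wqt.induct)
  case (complete K)
  then show ?case by (intro bidirectional_complete_not_embeds X)
next
  case (series G1 G2)
  show ?case
  proof
    assume "embeds X (G1 \<otimes>\<^sub>d G2)"
    from this X(1) have "embeds X G1 \<or> embeds X G2"
      by (rule embeds_cut)
        (use directed_co_wqt_arcs[OF series.hyps(1)] directed_co_wqt_arcs[OF series.hyps(2)]
          series.hyps(3) in
            \<open>auto simp: series_composition_def vertex_disjoint_def wqt_cut_def complete_on_def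
              bidirectional_complete_iff\<close>)
    with series.IH show False by blast
  qed
next
  case (order_right G K)
  show ?case
  proof
    assume "embeds X (G \<oslash>\<^sub>d K)"
    from this X(1) have "embeds X G \<or> embeds X K"
      by (rule embeds_cut)
        (use directed_co_wqt_arcs[OF order_right.hyps(1)] order_right.hyps(2)
          order_right.hyps(3) in
            \<open>auto simp: order_composition_def vertex_disjoint_def wqt_cut_def complete_on_def
              bidirectional_complete_iff\<close>)
    with order_right.IH show False using bidirectional_complete_not_embeds[OF order_right.hyps(2) X(2)] by blast
  qed
next
  case (order_left G K)
  show ?case
  proof
    assume "embeds X (K \<oslash>\<^sub>d G)"
    from this X(1) have "embeds X K \<or> embeds X G"
      by (rule embeds_cut)
        (use directed_co_wqt_arcs[OF order_left.hyps(1)] order_left.hyps(2)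
          order_left.hyps(3) in
            \<open>auto simp: order_composition_def vertex_disjoint_def wqt_cut_def complete_on_def
              bidirectional_complete_iff\<close>)
    with order_left.IH show False using bidirectional_complete_not_embeds[OF order_left.hyps(2) X(2)] by blast
  qed
next
  case (union G K)
  show ?case
  proof
    assume "embeds X (G \<oplus>\<^sub>d K)"
    from this X(1) have "embeds X G \<or> embeds X K"
      by (rule embeds_cut)
        (use directed_co_wqt_arcs[OF union.hyps(1)] union.hyps(2)
          union.hyps(3) in
            \<open>auto simp: disjoint_union_def vertex_disjoint_def wqt_cut_def complete_on_def
              bidirectional_complete_iff\<close>)
    with union.IH show False using bidirectional_complete_not_embeds[OF union.hyps(2) X(2)] by blast
  qed
qed

section \<open>The fifteen obstructions are inseparable, incomplete and well-formed\<close>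

lemmas graph_defs = D1_def D2_def D3_def D4_def D5_def D6_def D7_def D8_def Q1_def Q2_def Q3_def Q4_def Q5_def
  Q6_def Q7_def Y1_def Y2_def Y3_def Y4_def one_vertex_def both_arcs_def complement_def
  series_composition_def order_composition_def disjoint_union_def

text \<open>A cut is encoded as a predicate \<open>p\<close> on vertices. For an explicit vertex set
  the bounded quantifiers then expand to a propositional problem in the values of \<open>p\<close>,
  which \<open>argo\<close> can refute.\<close>

lemma wqt_separableE:
  assumes "wqt_separable X"
  obtains p where "\<exists>u\<in>pverts X. p u" "\<exists>u\<in>pverts X. \<not> p u"
    "(\<forall>u\<in>pverts X. \<forall>v\<in>pverts X. p u \<and> \<not> p v \<longrightarrow> (u, v) \<in> parcs X \<and> (v, u) \<in> parcs X) \<or>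
     (\<forall>u\<in>pverts X. \<forall>v\<in>pverts X. p u \<and> \<not> p v \<longrightarrow> (u, v) \<in> parcs X \<and> (v, u) \<notin> parcs X) \<and>
       ((\<forall>u\<in>pverts X. \<forall>v\<in>pverts X. p u \<and> p v \<and> u \<noteq> v \<longrightarrow> (u, v) \<in> parcs X) \<or>
        (\<forall>u\<in>pverts X. \<forall>v\<in>pverts X. \<not> p u \<and> \<not> p v \<and> u \<noteq> v \<longrightarrow> (u, v) \<in> parcs X)) \<or>
     (\<forall>u\<in>pverts X. \<forall>v\<in>pverts X. p u \<and> \<not> p v \<longrightarrow> (u, v) \<notin> parcs X \<and> (v, u) \<notin> parcs X) \<and>
        (\<forall>u\<in>pverts X. \<forall>v\<in>pverts X. \<not> p u \<and> \<not> p v \<and> u \<noteq> v \<longrightarrow> (u, v) \<in> parcs X)"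
proof -
  obtain A B where AB: "A \<noteq> {}" "B \<noteq> {}" "A \<inter> B = {}" "A \<union> B = pverts X" "wqt_cut (parcs X) A B"
    using assms unfolding wqt_separable_def by blast
  have cross: "(\<forall>a\<in>A. \<forall>b\<in>B. R a b) \<longleftrightarrow> (\<forall>u\<in>pverts X. \<forall>v\<in>pverts X. u \<in> A \<and> v \<notin> A \<longrightarrow> R u v)"
    and left: "(\<forall>u\<in>A. \<forall>v\<in>A. R u v) \<longleftrightarrow> (\<forall>u\<in>pverts X. \<forall>v\<in>pverts X. u \<in> A \<and> v \<in> A \<longrightarrow> R u v)"
    and right: "(\<forall>u\<in>B. \<forall>v\<in>B. R u v) \<longleftrightarrow> (\<forall>u\<in>pverts X. \<forall>v\<in>pverts X. u \<notin> A \<and> v \<notin> A \<longrightarrow> R u v)"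
    for R
    using AB(3) unfolding AB(4)[symmetric] by blast+
  show ?thesis
  proof (rule that[of "\<lambda>u. u \<in> A"])
    show "\<exists>u\<in>pverts X. u \<in> A" "\<exists>u\<in>pverts X. u \<notin> A" using AB by auto
  qed (use AB(5) in \<open>simp only: wqt_cut_def complete_on_def cross left right simp_thms imp_conjL conj_assoc\<close>)
qed

lemma obstructions_not_separable:
  "\<not> wqt_separable D1" "\<not> wqt_separable D2" "\<not> wqt_separable D3"
  "\<not> wqt_separable D4" "\<not> wqt_separable D5" "\<not> wqt_separable D6"
  "\<not> wqt_separable D7" "\<not> wqt_separable D8" "\<not> wqt_separable (complement Q1)"
  "\<not> wqt_separable (complement Q2)" "\<not> wqt_separable (complement Q3)"
  "\<not> wqt_separable (complement Q4)" "\<not> wqt_separable (complement Q5)"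
  "\<not> wqt_separable (complement Q6)" "\<not> wqt_separable (complement Q7)"
  by (rule notI, erule wqt_separableE, (simp add: graph_defs; argo))+

lemma obstructions_not_complete:
  "\<not> complete_on (parcs D1) (pverts D1)" "\<not> complete_on (parcs D2) (pverts D2)"
  "\<not> complete_on (parcs D3) (pverts D3)" "\<not> complete_on (parcs D4) (pverts D4)"
  "\<not> complete_on (parcs D5) (pverts D5)" "\<not> complete_on (parcs D6) (pverts D6)"
  "\<not> complete_on (parcs D7) (pverts D7)" "\<not> complete_on (parcs D8) (pverts D8)"
  "\<not> complete_on (parcs (complement Q1)) (pverts (complement Q1))"
  "\<not> complete_on (parcs (complement Q2)) (pverts (complement Q2))"
  "\<not> complete_on (parcs (complement Q3)) (pverts (complement Q3))"
  "\<not> complete_on (parcs (complement Q4)) (pverts (complement Q4))"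
  "\<not> complete_on (parcs (complement Q5)) (pverts (complement Q5))"
  "\<not> complete_on (parcs (complement Q6)) (pverts (complement Q6))"
  "\<not> complete_on (parcs (complement Q7)) (pverts (complement Q7))"
  by (auto simp: complete_on_def graph_defs)

lemma obstructions_wf:
  "pair_wf_digraph D1" "pair_wf_digraph D2" "pair_wf_digraph D3" "pair_wf_digraph D4"
  "pair_wf_digraph D5" "pair_wf_digraph D6" "pair_wf_digraph D7" "pair_wf_digraph D8"
  "pair_wf_digraph (complement Q1)" "pair_wf_digraph (complement Q2)"
  "pair_wf_digraph (complement Q3)" "pair_wf_digraph (complement Q4)"
  "pair_wf_digraph (complement Q5)" "pair_wf_digraph (complement Q6)"
  "pair_wf_digraph (complement Q7)"
  by (auto simp: pair_wf_digraph_def graph_defs)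

section \<open>Decomposition of obstruction-free digraphs\<close>

definition induced :: "'a pair_pre_digraph \<Rightarrow> 'a set \<Rightarrow> 'a pair_pre_digraph" where
  "induced G S = \<lparr>pverts = S, parcs = parcs G \<inter> S \<times> S\<rparr>"

text \<open>The relation is a parameter, so that one minimality argument serves \<open>non\<close>,
  \<open>arrow\<close> and the reverse of \<open>arrow\<close>.\<close>

definition cutset :: "('a \<Rightarrow> 'a \<Rightarrow> bool) \<Rightarrow> 'a set \<Rightarrow> 'a set \<Rightarrow> bool" where
  "cutset r S A \<longleftrightarrow> A \<noteq> {} \<and> A \<subset> S \<and> (\<forall>a\<in>A. \<forall>b\<in>S - A. r a b)"

text \<open>A cut of \<open>A\<close> is again a cut of \<open>S\<close>, because its elements
  already stand in relation \<open>r\<close> to everything outside \<open>A\<close>. Descent through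
  finite sets therefore ends at a part without cuts.\<close>

lemma minimal_cutset:
  assumes "finite S" "cutset r S A0"
  obtains A where "A \<subseteq> A0" "cutset r S A" "\<And>A'. \<not> cutset r A A'"
proof -
  have "finite A0" using assms by (auto simp: cutset_def intro: finite_subset)
  then have "\<exists>A\<subseteq>A0. cutset r S A \<and> (\<forall>A'. \<not> cutset r A A')"
    using assms(2)
  proof (induction A0 rule: finite_psubset_induct)
    case (psubset A)
    show ?case
    proof (cases "\<exists>A'. cutset r A A'")
      case True
      then obtain A' where A': "cutset r A A'" ..
      with psubset.prems have sub: "A' \<subset> A" and cut: "cutset r S A'" unfolding cutset_def by blast+
      from psubset.IH[OF sub cut] sub show ?thesis by (meson order_trans psubset_imp_subset)
    qed (use psubset.prems in blast)
  qed
  then show ?thesis using that by blast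
qed

section \<open>Forbidden patterns as rules on pairs of vertices\<close>

locale obstruction_free = pair_digraph G for G :: "'a pair_pre_digraph" +
  assumes no_obstruction: "X \<in> {D1, D2, D3, D4, D5, D6, D7, D8} \<union> complement ` {Q1, Q2, Q3, Q4, Q5, Q6, Q7}
    \<Longrightarrow> \<not> embeds X G"
begin

abbreviation "V \<equiv> pverts G"

definition arrow :: "'a \<Rightarrow> 'a \<Rightarrow> bool" where
  "arrow u v \<longleftrightarrow> (u, v) \<in> parcs G \<and> (v, u) \<notin> parcs G"

definition bid :: "'a \<Rightarrow> 'a \<Rightarrow> bool" where
  "bid u v \<longleftrightarrow> (u, v) \<in> parcs G \<and> (v, u) \<in> parcs G"

definition non :: "'a \<Rightarrow> 'a \<Rightarrow> bool" where
  "non u v \<longleftrightarrow> u \<noteq> v \<and> (u, v) \<notin> parcs G \<and> (v, u) \<notin> parcs G"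

lemmas rel_defs = arrow_def bid_def non_def

lemma loopless: "(u, u) \<notin> parcs G"
  using no_loops' by blast

lemma arrow_irrefl: "\<not> arrow u u"
  by (simp add: arrow_def)

lemma bid_sym: "bid u v \<Longrightarrow> bid v u"
  by (simp add: bid_def)

lemma non_sym: "non u v \<Longrightarrow> non v u"
  by (auto simp: non_def)

lemma rel_cases:
  assumes "u \<noteq> v"
  obtains "arrow u v" | "arrow v u" | "bid u v" | "non u v"
  using assms by (auto simp: rel_defs)

text \<open>Vertex \<open>i\<close> of the pattern is placed at \<open>xs ! i\<close>. For a
  concrete list all conditions reduce to statements about finitely many arcs.\<close>

lemma no_pattern:
  assumes "X \<in> {D1, D2, D3, D4, D5, D6, D7, D8} \<union> complement ` {Q1, Q2, Q3, Q4, Q5, Q6, Q7}"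
    "distinct xs" "set xs \<subseteq> V" "\<forall>i. i \<in> pverts X \<longleftrightarrow> i < length xs"
    "\<forall>i<length xs. \<forall>j<length xs. (i, j) \<in> parcs X \<longleftrightarrow> (xs ! i, xs ! j) \<in> parcs G"
  shows False
proof -
  have "pverts X = {0..<length xs}"
    by (rule set_eqI) (simp only: assms(4) atLeast0LessThan lessThan_iff)
  from embeds_listI[OF assms(2,3) this assms(5)] no_obstruction[OF assms(1)] show False by simp
qed

lemma all_less_Suc: "(\<forall>i<Suc n. P i) \<longleftrightarrow> (\<forall>i<n. P i) \<and> P n"
  by (auto simp: less_Suc_eq)

lemmas pattern_simps = graph_defs all_less_Suc less_Suc_eq eval_nat_numeral rel_defs loopless disj_assoc

text \<open>No vertex of a forbidden digraph is isolated, so membership in \<open>V\<close> follows from the arcs.\<close>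

lemma no_D1: "\<lbrakk>arrow a b; arrow b c; non a c\<rbrakk> \<Longrightarrow> False"
  by (rule no_pattern[of D1 "[a, b, c]"]) (auto simp: pattern_simps dest: wellformed')

lemma no_D2: "\<lbrakk>arrow a b; bid b c; non a c\<rbrakk> \<Longrightarrow> False"
  by (rule no_pattern[of D2 "[a, b, c]"]) (auto simp: pattern_simps dest: wellformed')

lemma no_D3: "\<lbrakk>arrow b a; bid b c; non a c\<rbrakk> \<Longrightarrow> False"
  by (rule no_pattern[of D3 "[a, b, c]"]) (auto simp: pattern_simps dest: wellformed')

lemma no_D4: "\<lbrakk>arrow a b; arrow b c; bid a c\<rbrakk> \<Longrightarrow> False"
  by (rule no_pattern[of D4 "[a, b, c]"]) (auto simp: pattern_simps dest: wellformed')

lemma no_D5: "\<lbrakk>arrow a b; arrow b c; arrow c a\<rbrakk> \<Longrightarrow> False"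
  by (rule no_pattern[of D5 "[a, b, c]"]) (auto simp: pattern_simps dest: wellformed')

lemma no_D6: "\<lbrakk>arrow b a; arrow b c; arrow d c; bid a c; bid a d; bid b d\<rbrakk> \<Longrightarrow> False"
  by (rule no_pattern[of D6 "[a, b, c, d]"]) (auto simp: pattern_simps dest: wellformed')

lemma no_D7: "\<lbrakk>bid a b; bid b c; bid c d; non a c; non a d; non b d\<rbrakk> \<Longrightarrow> False"
  by (rule no_pattern[of D7 "[a, b, c, d]"]) (auto simp: pattern_simps dest: wellformed')

lemma no_D8: "\<lbrakk>arrow a b; arrow c b; arrow c d; non a c; non a d; non b d\<rbrakk> \<Longrightarrow> False"
  by (rule no_pattern[of D8 "[a, b, c, d]"]) (auto simp: pattern_simps dest: wellformed')

text \<open>Complementation exchanges \<open>bid\<close> and \<open>non\<close> and reverses every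
  \<open>arrow\<close>. Hence in the \<open>co-Q\<close> patterns the two blocks are joined by
  \<open>non\<close>, or by arrows from the second block to the first. A block is a
  \<open>non\<close> pair or an arrow, possibly with a third vertex joined to both ends by
  \<open>bid\<close>.\<close>

lemma no_co_Q1: "\<lbrakk>arrow b a; arrow d c; non a c; non a d; non b c; non b d\<rbrakk> \<Longrightarrow> False"
  by (rule no_pattern[of "complement Q1" "[a, b, c, d]"]) (auto simp: pattern_simps dest: wellformed')

lemma no_co_Q2: "\<lbrakk>non a b; non c d; arrow c a; arrow c b; arrow d a; arrow d b\<rbrakk> \<Longrightarrow> False"
  by (rule no_pattern[of "complement Q2" "[a, b, c, d]"]) (auto simp: pattern_simps dest: wellformed')

lemma no_co_Q3: "\<lbrakk>non a b; bid a c; bid b c; non a' b'; bid a' c'; bid b' c';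
    \<forall>x\<in>{a, b, c}. \<forall>y\<in>{a', b', c'}. non x y\<rbrakk> \<Longrightarrow> False"
  by (rule no_pattern[of "complement Q3" "[a, b, c, a', b', c']"]) (auto simp: pattern_simps dest: wellformed')

lemma no_co_Q4: "\<lbrakk>arrow b a; non a' b'; bid a' c'; bid b' c';
    \<forall>x\<in>{a, b}. \<forall>y\<in>{a', b', c'}. non x y\<rbrakk> \<Longrightarrow> False"
  by (rule no_pattern[of "complement Q4" "[a, b, a', b', c']"]) (auto simp: pattern_simps dest: wellformed')

lemma no_co_Q5: "\<lbrakk>non a b; arrow b' a'; bid a' c'; bid b' c';
    \<forall>x\<in>{a', b', c'}. \<forall>y\<in>{a, b}. arrow x y\<rbrakk> \<Longrightarrow> False"
  by (rule no_pattern[of "complement Q5" "[a, b, a', b', c']"]) (auto simp: pattern_simps dest: wellformed')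

lemma no_co_Q6: "\<lbrakk>arrow b a; bid a c; bid b c; non a' b';
    \<forall>x\<in>{a', b'}. \<forall>y\<in>{a, b, c}. arrow x y\<rbrakk> \<Longrightarrow> False"
  by (rule no_pattern[of "complement Q6" "[a, b, c, a', b']"]) (auto simp: pattern_simps dest: wellformed')

lemma no_co_Q7: "\<lbrakk>arrow b a; bid a c; bid b c; arrow b' a'; bid a' c'; bid b' c';
    \<forall>x\<in>{a', b', c'}. \<forall>y\<in>{a, b, c}. arrow x y\<rbrakk> \<Longrightarrow> False"
  by (rule no_pattern[of "complement Q7" "[a, b, c, a', b', c']"]) (auto simp: pattern_simps dest: wellformed')

text \<open>\<open>D1\<close>, \<open>D4\<close> and \<open>D5\<close> exclude the three other
  relations between \<open>a\<close> and \<open>c\<close>.\<close>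

lemma arrow_trans: "\<lbrakk>arrow a b; arrow b c\<rbrakk> \<Longrightarrow> arrow a c"
proof -
  assume ab: "arrow a b" and bc: "arrow b c"
  then have "a \<noteq> c" by (auto simp: arrow_def)
  then show ?thesis
    using no_D1[OF ab bc] no_D4[OF ab bc] no_D5[OF ab bc] by (cases rule: rel_cases) auto
qed

section \<open>The colouring of pairs by their number of arcs\<close>

definition arc_count :: "'a \<Rightarrow> 'a \<Rightarrow> nat" where
  "arc_count u v = of_bool ((u, v) \<in> parcs G) + of_bool ((v, u) \<in> parcs G)"

lemma arc_count_sym: "arc_count u v = arc_count v u"
  by (simp add: arc_count_def)

lemma arc_count_cases: "arc_count u v = 0 \<or> arc_count u v = 1 \<or> arc_count u v = 2"
  by (simp add: arc_count_def)

text \<open>Colour 1 forgets the direction of an arc, which \<open>orient_cut\<close> later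
  restores. It is also stated as \<open>Suc 0\<close>, the form to which the simplifier rewrites
  it.\<close>

lemma arc_count_iff:
  "u \<noteq> v \<Longrightarrow> arc_count u v = 0 \<longleftrightarrow> non u v"
  "arc_count u v = 1 \<longleftrightarrow> arrow u v \<or> arrow v u"
  "arc_count u v = Suc 0 \<longleftrightarrow> arrow u v \<or> arrow v u"
  "arc_count u v = 2 \<longleftrightarrow> bid u v"
  by (auto simp: arc_count_def rel_defs)

text \<open>The two directions of the one-way arc give \<open>D2\<close> and
  \<open>D3\<close>.\<close>

lemma no_rainbow_aux: "\<lbrakk>non x y; bid y z; arrow x z \<or> arrow z x\<rbrakk> \<Longrightarrow> False"
  using no_D2[of x z y] no_D3[of z x y] bid_sym[of y z] by blast

text \<open>The six ways to distribute three colours over a triangle differ only by renaming its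
  vertices.\<close>

lemma no_rainbow:
  assumes "distinct [x, y, z]"
  shows "\<not> distinct [arc_count x y, arc_count y z, arc_count x z]"
proof
  assume *: "distinct [arc_count x y, arc_count y z, arc_count x z]"
  have aux: False if "u \<noteq> v" "arc_count u v = 0" "arc_count v w = 2" "arc_count u w = 1" for u v w
    using that arc_count_iff no_rainbow_aux[of u v w] by auto
  have perm: "(p, q, r) \<in> {(0, 1, 2), (0, 2, 1), (1, 0, 2), (1, 2, 0), (2, 0, 1), (2, 1, 0)}"
    if "distinct [p, q, r]" "p = 0 \<or> p = 1 \<or> p = 2" "q = 0 \<or> q = 1 \<or> q = 2" "r = 0 \<or> r = 1 \<or> r = 2"
    for p q r :: nat
    using that by (elim disjE) simp_all
  from assms have "x \<noteq> y" "x \<noteq> z" "y \<noteq> z" by auto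
  with perm[OF * arc_count_cases arc_count_cases arc_count_cases] show False
    using aux[of x y z] aux[of y x z] aux[of x z y] aux[of z x y] aux[of y z x] aux[of z y x]
    unfolding arc_count_sym[of y x] arc_count_sym[of z y] arc_count_sym[of z x]
    by (elim insertE) simp_all
qed

text \<open>Here \<open>d\<close> is the colour of the path and \<open>c\<close> that of the other
  pairs. A path of colour 1 either has two consecutive arcs in the same direction, giving
  \<open>D1\<close> or \<open>D4\<close>, or alternates, giving \<open>D8\<close> or
  \<open>D6\<close>.\<close>

lemma no_bichromatic_P4_aux:
  assumes "distinct [w, x, y, z]" and dc: "(d, c) \<in> {(2, 0), (1, 0), (1, 2)}"
    and "arc_count w x = d" "arc_count x y = d" "arc_count y z = d"
    and "arc_count w y = c" "arc_count w z = c" "arc_count x z = c"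
  shows False
  using dc
proof (elim insertE emptyE)
  assume "(d, c) = (2, 0)"
  then show ?thesis using assms no_D7[of w x y z] by (simp add: arc_count_iff)
next
  assume "(d, c) = (1, 0)"
  with assms have *: "arrow w x \<or> arrow x w" "arrow x y \<or> arrow y x" "arrow y z \<or> arrow z y"
    "non w y" "non w z" "non x z" by (auto simp: arc_count_iff)
  then show False
    using no_D1[of w x y] no_D1[of y x w] no_D1[of x y z] no_D1[of z y x] no_D8[of w x y z] no_D8[of z y x w]
      non_sym by blast
next
  assume "(d, c) = (1, 2)"
  with assms have *: "arrow w x \<or> arrow x w" "arrow x y \<or> arrow y x" "arrow y z \<or> arrow z y"
    "bid w y" "bid w z" "bid x z" by (auto simp: arc_count_iff)
  then show False
    using no_D4[of w x y] no_D4[of y x w] no_D4[of x y z] no_D4[of z y x] no_D6[of x w y z] no_D6[of y z x w]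
      bid_sym by blast
qed

text \<open>The complement of the path \<open>w x y z\<close> is the path \<open>y w z x\<close>, so the two colours may be exchanged.\<close>

lemma no_bichromatic_P4:
  assumes dist: "distinct [w, x, y, z]" and "c \<noteq> d"
    and d: "arc_count w x = d" "arc_count x y = d" "arc_count y z = d"
    and c: "arc_count w y = c" "arc_count w z = c" "arc_count x z = c"
  shows False
proof -
  have "c \<in> {0, 1, 2}" "d \<in> {0, 1, 2}"
    using arc_count_cases[of w x] arc_count_cases[of w y] d c by auto
  with \<open>c \<noteq> d\<close> consider "(d, c) \<in> {(2, 0), (1, 0), (1, 2)}" | "(c, d) \<in> {(2, 0), (1, 0), (1, 2)}"
    by auto
  then show ?thesis
  proof cases
    case 1
    show ?thesis by (rule no_bichromatic_P4_aux[OF dist 1 d c])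
  next
    case 2
    have "distinct [y, w, z, x]" using dist by auto
    then show ?thesis
      by (rule no_bichromatic_P4_aux[OF _ 2]) (simp_all add: d c arc_count_sym[of y w] arc_count_sym[of z x]
          arc_count_sym[of y x] arc_count_sym[of w x])
  qed
qed

text \<open>If all pairs across a cut are comparable in the strict order \<open>arrow\<close>, then the incomparability
  component \<open>L\<close> of a minimal element is a proper subset lying below everything else.\<close>

lemma orient_cut_aux:
  assumes "S = A \<union> B" "A \<inter> B = {}" "B \<noteq> {}"
    and cross: "\<And>a b. a \<in> A \<Longrightarrow> b \<in> B \<Longrightarrow> arrow a b \<or> arrow b a"
    and m: "m \<in> A" "\<And>x. x \<in> S \<Longrightarrow> \<not> arrow x m"
  shows "\<exists>L. cutset arrow S L"
proof -
  define inc where "inc x y \<longleftrightarrow> x \<in> S \<and> y \<in> S \<and> \<not> arrow x y \<and> \<not> arrow y x" for x y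
  define L where "L = {x. inc\<^sup>*\<^sup>* m x}"
  have "x \<in> A" if "inc\<^sup>*\<^sup>* m x" for x
    using that
  proof induction
    case (step x y)
    then show ?case using assms(1) cross[of x y] by (auto simp: inc_def)
  qed (rule m)
  then have "L \<subseteq> A" by (auto simp: L_def)
  \<comment> \<open>Being below \<open>b\<close> spreads along the component: a neighbour
    \<open>y\<close> of \<open>x\<close> is comparable to \<open>b\<close>, and if \<open>b\<close>
    were below \<open>y\<close>, transitivity would put \<open>x\<close> below
    \<open>y\<close>.\<close>
  moreover have "arrow x b" if "b \<in> S - L" "inc\<^sup>*\<^sup>* m x" for b x
    using that(2)
  proof induction
    case base
    have "\<not> inc m b" using that(1) by (auto simp: L_def)
    then show ?case using that(1) m assms(1) by (auto simp: inc_def)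
  next
    case (step x y)
    have "\<not> inc y b"
      using that(1) rtranclp.rtrancl_into_rtrancl[OF rtranclp.rtrancl_into_rtrancl[OF step.hyps]]
      by (auto simp: L_def)
    then show ?case
      using that(1) step arrow_trans[of x b y] by (auto simp: inc_def)
  qed
  moreover have "m \<in> L" by (simp add: L_def)
  ultimately have "cutset arrow S L"
    using assms(1-3) unfolding cutset_def L_def by blast
  then show ?thesis ..
qed

text \<open>A minimal element of the finite strict order on \<open>S\<close> lies in one of the two
  parts, whose roles are symmetric.\<close>

lemma orient_cut:
  assumes "finite S" "S = A \<union> B" "A \<inter> B = {}" "A \<noteq> {}" "B \<noteq> {}"
    and cross: "\<And>a b. a \<in> A \<Longrightarrow> b \<in> B \<Longrightarrow> arrow a b \<or> arrow b a"
  shows "\<exists>L. cutset arrow S L"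
proof -
  have "asymp_on S arrow" by (auto simp: asymp_on_def arrow_def)
  moreover have "transp_on S arrow" by (auto simp: transp_on_def intro: arrow_trans)
  ultimately obtain m where m: "m \<in> S" "\<And>x. x \<in> S \<Longrightarrow> \<not> arrow x m"
    using Finite_Set.bex_min_element[of S arrow] assms(1,2,4) arrow_irrefl by (metis Un_empty)
  show ?thesis
  proof (cases "m \<in> A")
    case True
    show ?thesis by (rule orient_cut_aux[OF assms(2,3,5) cross True m(2)])
  next
    case False
    with m assms(2) have "m \<in> B" by simp
    show ?thesis
      by (rule orient_cut_aux[of S B A m]) (use assms m \<open>m \<in> B\<close> cross in blast)+
  qed
qed

text \<open>A monochromatic cut of colour 0 or 2 is kept as it is; one of colour 1 is exchanged for
  a possibly different cut by \<open>orient_cut\<close>.\<close>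

lemma uniform_cut:
  assumes S: "S \<subseteq> V" "2 \<le> card S"
  obtains A where "cutset bid S A" | A where "cutset non S A" | A where "cutset arrow S A"
proof -
  have fin: "finite S" using S(1) pair_finite_verts finite_subset by blast
  have "\<exists>A B c. A \<noteq> {} \<and> B \<noteq> {} \<and> A \<inter> B = {} \<and> A \<union> B = S \<and> (\<forall>a\<in>A. \<forall>b\<in>B. arc_count a b = c)"
    by (rule monochromatic_cut[OF fin S(2) arc_count_sym no_rainbow no_bichromatic_P4])
  then obtain A B c where AB: "A \<noteq> {}" "B \<noteq> {}" "A \<inter> B = {}" "A \<union> B = S"
    and cross: "\<And>a b. a \<in> A \<Longrightarrow> b \<in> B \<Longrightarrow> arc_count a b = c" by blast
  have B: "S - A = B" "A \<subset> S" using AB by auto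
  have neq: "a \<noteq> b" if "a \<in> A" "b \<in> B" for a b using that AB by auto
  obtain a b where ab: "a \<in> A" "b \<in> B" using AB by blast
  from arc_count_cases[of a b] consider "c = 0" | "c = 1" | "c = 2"
    unfolding cross[OF ab] by blast
  then show ?thesis
  proof cases
    case 1
    with cross neq have "cutset non S A" using AB B by (auto simp: cutset_def arc_count_iff)
    then show ?thesis by (rule that)
  next
    case 2
    with cross have "arrow a b \<or> arrow b a" if "a \<in> A" "b \<in> B" for a b
      using that by (simp add: arc_count_iff)
    from orient_cut[OF fin AB(4)[symmetric] AB(3,1,2) this] that(3) show ?thesis by blast
  next
    case 3
    with cross have "cutset bid S A" using AB B by (auto simp: cutset_def arc_count_iff)
    then show ?thesis by (rule that)
  qed
qed

text \<open>Each alternative of \<open>wqt_cut\<close> turns into one operation on the two induced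
  parts, with the complete part as the operand \<open>K\<close> where a rule asks for one.\<close>

lemma induced_glue:
  assumes wqt: "directed_co_wqt (induced G A)" "directed_co_wqt (induced G B)"
    and AB: "A \<noteq> {}" "B \<noteq> {}" "A \<inter> B = {}" "A \<union> B \<subseteq> V"
    and cut: "wqt_cut (parcs G) A B"
  shows "directed_co_wqt (induced G (A \<union> B))"
proof -
  have fin: "finite A" "finite B"
    using AB(4) pair_finite_verts by (auto intro: finite_subset)
  have disj: "vertex_disjoint (induced G A) (induced G B)" "vertex_disjoint (induced G B) (induced G A)"
    using AB(3) by (auto simp: vertex_disjoint_def induced_def)
  have compl: "bidirectional_complete (induced G C)" if "complete_on (parcs G) C" "finite C" "C \<noteq> {}" for C
    using that by (auto simp: bidirectional_complete_iff induced_def complete_on_def loopless)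
  from cut consider
    "\<And>a b. a \<in> A \<Longrightarrow> b \<in> B \<Longrightarrow> (a, b) \<in> parcs G \<and> (b, a) \<in> parcs G"
    | "\<And>a b. a \<in> A \<Longrightarrow> b \<in> B \<Longrightarrow> (a, b) \<in> parcs G \<and> (b, a) \<notin> parcs G"
      "complete_on (parcs G) A \<or> complete_on (parcs G) B"
    | "\<And>a b. a \<in> A \<Longrightarrow> b \<in> B \<Longrightarrow> (a, b) \<notin> parcs G \<and> (b, a) \<notin> parcs G" "complete_on (parcs G) B"
    unfolding wqt_cut_def by blast
  then show ?thesis
  proof cases
    case 1
    then have "induced G (A \<union> B) = induced G A \<otimes>\<^sub>d induced G B"
      by (auto simp: induced_def series_composition_def)
    then show ?thesis using wqt disj by (simp add: directed_co_wqt.series)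
  next
    case 2
    then have eq: "induced G (A \<union> B) = induced G A \<oslash>\<^sub>d induced G B"
      by (auto simp: induced_def order_composition_def)
    from 2(2) show ?thesis
    proof
      assume "complete_on (parcs G) A"
      then show ?thesis
        unfolding eq by (intro directed_co_wqt.order_left wqt compl disj fin AB)
    next
      assume "complete_on (parcs G) B"
      then show ?thesis
        unfolding eq by (intro directed_co_wqt.order_right wqt compl disj fin AB)
    qed
  next
    case 3
    then have "induced G (A \<union> B) = induced G A \<oplus>\<^sub>d induced G B"
      by (auto simp: induced_def disjoint_union_def)
    then show ?thesis
      by (simp only:) (intro directed_co_wqt.union wqt compl disj fin AB 3(2))
  qed
qed

text \<open>Without arrows all pairs are \<open>bid\<close> or \<open>non\<close>, and the
  \<open>bid\<close> graph is connected. For a \<open>non\<close> pair \<open>x\<close>,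
  \<open>y\<close>, the closed neighbourhood \<open>X\<close> of \<open>x\<close> misses
  \<open>y\<close>, so some \<open>bid\<close> pair \<open>u\<close>, \<open>w\<close> leaves it;
  then \<open>u\<close> is the middle of an induced path from \<open>x\<close> to
  \<open>w\<close>.\<close>

lemma noncomplete_connected:
  assumes "\<not> complete_on (parcs G) A" "\<And>A'. \<not> cutset non A A'"
  obtains x y where "x \<in> A" "y \<in> A" "arrow x y"
  | x y z where "x \<in> A" "y \<in> A" "z \<in> A" "non x y" "bid x z" "bid y z"
proof (cases "\<exists>x\<in>A. \<exists>y\<in>A. arrow x y")
  case True
  then show ?thesis using that(1) by blast
next
  case False
  from assms(1) obtain x y where xy: "x \<in> A" "y \<in> A" "x \<noteq> y" "(x, y) \<notin> parcs G"
    by (auto simp: complete_on_def)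
  with False have non: "non x y" by (auto simp: rel_defs)
  define X where "X = insert x {z \<in> A. bid x z}"
  have "X \<noteq> {}" "X \<subset> A" using xy non by (auto simp: X_def rel_defs)
  with assms(2)[of X] obtain u w where uw: "u \<in> X" "w \<in> A - X" "\<not> non u w"
    by (auto simp: cutset_def)
  moreover have "u \<in> A" using uw xy by (auto simp: X_def)
  ultimately have "bid u w" using False by (auto simp: rel_defs)
  with uw have "u \<noteq> x" "w \<noteq> x" "\<not> bid x w" by (auto simp: X_def)
  with uw xy False have "non x w" by (auto simp: rel_defs)
  moreover have "bid x u" using uw \<open>u \<noteq> x\<close> by (auto simp: X_def)
  ultimately show ?thesis
    using that(2)[of x w u] xy uw \<open>u \<in> A\<close> bid_sym[OF \<open>bid u w\<close>] by blast
qed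

text \<open>Without \<open>non\<close> pairs a missing arc means an arrow, and the only uniform cut
  left is a \<open>bid\<close> cut. Such a cut cannot separate the ends of the arrow, so any vertex
  on the other side completes the pattern.\<close>

lemma noncomplete_no_order_cut:
  assumes A: "A \<subseteq> V" "\<not> complete_on (parcs G) A" "\<And>A'. \<not> cutset arrow A A'"
  obtains x y where "x \<in> A" "y \<in> A" "non x y"
  | x y z where "x \<in> A" "y \<in> A" "z \<in> A" "arrow x y" "bid x z" "bid y z"
proof (cases "\<exists>x\<in>A. \<exists>y\<in>A. non x y")
  case True
  then show ?thesis using that(1) by blast
next
  case False
  from A(2) obtain u v where uv: "u \<in> A" "v \<in> A" "u \<noteq> v" "(u, v) \<notin> parcs G"
    by (auto simp: complete_on_def)
  with False have vu: "arrow v u" by (auto simp: rel_defs)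
  have "finite A" using A(1) pair_finite_verts finite_subset by blast
  then have "card {u, v} \<le> card A" using uv by (intro card_mono) auto
  then have "2 \<le> card A" using uv by simp
  with A(1) show ?thesis
  proof (cases rule: uniform_cut)
    case (1 B)
    then have B: "B \<noteq> {}" "B \<subset> A" and cross: "\<And>a b. a \<in> B \<Longrightarrow> b \<in> A - B \<Longrightarrow> bid a b"
      by (auto simp: cutset_def)
    have "u \<in> B \<longleftrightarrow> v \<in> B"
      using cross[of u v] cross[of v u] vu uv by (auto simp: rel_defs)
    then show ?thesis
    proof (cases "u \<in> B")
      case True
      from B obtain z where "z \<in> A - B" by blast
      with True \<open>u \<in> B \<longleftrightarrow> v \<in> B\<close> cross uv vu show ?thesis by (intro that(2)[of v u z]) auto
    next
      case False
      from B obtain z where z: "z \<in> B" by blast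
      then have "bid z v" "bid z u" using False \<open>u \<in> B \<longleftrightarrow> v \<in> B\<close> cross uv by auto
      then show ?thesis using z B uv vu bid_sym by (intro that(2)[of v u z]) auto
    qed
  next
    case (2 B)
    then obtain a b where "a \<in> B" "b \<in> A - B" "non a b" "B \<subset> A" unfolding cutset_def by blast
    with False show ?thesis by auto
  next
    case (3 B)
    with A(3) show ?thesis by blast
  qed
qed

text \<open>A cut without arcs is refined to two inclusion-minimal ones, \<open>A\<close> and \<open>B\<close> (connected components);
  an order cut to a minimal lower end \<open>L\<close> and a minimal upper end \<open>R\<close>. If neither of the two parts
  is complete, both contain a pattern, and the two patterns together form some \<open>co-Q\<^sub>i\<close>.\<close>

lemma non_cut_complete_part:
  assumes "finite S" "cutset non S A0"
  obtains A where "cutset non S A" "complete_on (parcs G) A"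
proof -
  obtain A where A: "cutset non S A" "\<And>A'. \<not> cutset non A A'"
    using minimal_cutset[OF assms] by metis
  \<comment> \<open>Symmetry of \<open>non\<close> lets the complement serve as a second cut, in
    which a minimal \<open>B\<close> disjoint from \<open>A\<close> is found.\<close>
  then have "cutset non S (S - A)" using non_sym by (auto simp: cutset_def)
  then obtain B where B: "B \<subseteq> S - A" "cutset non S B" "\<And>A'. \<not> cutset non B A'"
    using minimal_cutset[OF assms(1)] by metis
  have cross: "non a b" if "a \<in> A" "b \<in> B" for a b
    using that A(1) B(1) by (auto simp: cutset_def)
  have "complete_on (parcs G) A \<or> complete_on (parcs G) B"
  proof (rule ccontr)
    assume "\<not> ?thesis"
    then have nc: "\<not> complete_on (parcs G) A" "\<not> complete_on (parcs G) B" by auto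
    show False
    proof (cases rule: noncomplete_connected[OF nc(1) A(2)])
      case A: (1 x y)
      show False
      proof (cases rule: noncomplete_connected[OF nc(2) B(3)])
        case (1 x' y')
        show False by (rule no_co_Q1[OF A(3) 1(3)]; intro cross A 1)
      next
        case (2 x' y' z')
        show False by (rule no_co_Q4[OF A(3) 2(4-6)]) (use cross A 2 in auto)
      qed
    next
      case A: (2 x y z)
      show False
      proof (cases rule: noncomplete_connected[OF nc(2) B(3)])
        case (1 x' y')
        show False by (rule no_co_Q4[OF 1(3) A(4-6)]) (use cross[THEN non_sym] A 1 in auto)
      next
        case (2 x' y' z')
        show False by (rule no_co_Q3[OF A(4-6) 2(4-6)]) (use cross A 2 in auto)
      qed
    qed
  qed
  then show ?thesis using A(1) B(2) that by blast
qed

lemma order_cut_complete_part: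
  assumes S: "finite S" "S \<subseteq> V" and cut: "cutset arrow S A0"
  obtains A where "cutset arrow S A" "complete_on (parcs G) A \<or> complete_on (parcs G) (S - A)"
proof -
  obtain L where L: "cutset arrow S L" "\<And>A'. \<not> cutset arrow L A'"
    using minimal_cutset[OF S(1) cut] by metis
  then have "cutset (\<lambda>x y. arrow y x) S (S - L)" by (auto simp: cutset_def)
  then obtain R where R: "R \<subseteq> S - L" "cutset (\<lambda>x y. arrow y x) S R"
    "\<And>A'. \<not> cutset (\<lambda>x y. arrow y x) R A'"
    using minimal_cutset[OF S(1)] by metis
  \<comment> \<open>Within \<open>R\<close>, the complement of an \<open>arrow\<close> cut would be
    a cut for the reversed relation.\<close>
  have R_arrow: "\<not> cutset arrow R A'" for A'
    using R(3)[of "R - A'"] by (auto simp: cutset_def)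
  have cross: "arrow a b" if "a \<in> L" "b \<in> R" for a b
    using that L(1) R(1) by (auto simp: cutset_def)
  have sub: "L \<subseteq> V" "R \<subseteq> V" using S(2) L(1) R(1) by (auto simp: cutset_def)
  have "complete_on (parcs G) L \<or> complete_on (parcs G) R"
  proof (rule ccontr)
    assume "\<not> ?thesis"
    then have nc: "\<not> complete_on (parcs G) L" "\<not> complete_on (parcs G) R" by auto
    show False
    proof (cases rule: noncomplete_no_order_cut[OF sub(1) nc(1) L(2)])
      case L: (1 x y)
      show False
      proof (cases rule: noncomplete_no_order_cut[OF sub(2) nc(2) R_arrow])
        case (1 x' y')
        show False by (rule no_co_Q2[OF 1(3) L(3)]; intro cross L 1)
      next
        case (2 x' y' z')
        show False by (rule no_co_Q6[OF 2(4) _ _ L(3), of z']) (use cross L 2 in auto)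
      qed
    next
      case L: (2 x y z)
      show False
      proof (cases rule: noncomplete_no_order_cut[OF sub(2) nc(2) R_arrow])
        case (1 x' y')
        show False by (rule no_co_Q5[OF 1(3) L(4), of z]) (use cross L 1 in auto)
      next
        case (2 x' y' z')
        show False by (rule no_co_Q7[OF 2(4) _ _ L(4), of z' z]) (use cross L 2 in auto)
      qed
    qed
  qed
  then show ?thesis
  proof
    assume "complete_on (parcs G) L"
    then show ?thesis using that L(1) by blast
  next
    assume R_compl: "complete_on (parcs G) R"
    \<comment> \<open>\<open>R\<close> is an upper end, so the lower side to return is
      \<open>S - R\<close>.\<close>
    have "S - (S - R) = R" "cutset arrow S (S - R)" using R(2) by (auto simp: cutset_def)
    then show ?thesis using that R_compl by metis
  qed
qed

text \<open>Strong induction on the vertex set: a uniform cut, improved to have a complete part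
  unless it is a \<open>bid\<close> cut, splits \<open>S\<close> into two smaller sets that are
  glued again.\<close>

lemma directed_co_wqt_induced:
  assumes "S \<subseteq> V" "S \<noteq> {}"
  shows "directed_co_wqt (induced G S)"
proof -
  have "finite S" using assms(1) pair_finite_verts finite_subset by blast
  then show ?thesis
    using assms
  proof (induction S rule: finite_psubset_induct)
    case (psubset S)
    have step: ?case if A: "A \<noteq> {}" "A \<subset> S"
      and cut: "wqt_cut (parcs G) A (S - A) \<or> wqt_cut (parcs G) (S - A) A" for A
    proof -
      have wqt: "directed_co_wqt (induced G A)" "directed_co_wqt (induced G (S - A))"
        using A psubset.prems by (auto intro!: psubset.IH)
      have eq: "A \<union> (S - A) = S" "(S - A) \<union> A = S" and ne: "S - A \<noteq> {}" using A by auto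
      from cut show ?thesis
      proof
        assume "wqt_cut (parcs G) A (S - A)"
        from induced_glue[OF wqt A(1) ne _ _ this] show ?thesis
          unfolding eq using psubset.prems by auto
      next
        assume "wqt_cut (parcs G) (S - A) A"
        from induced_glue[OF wqt(2,1) ne A(1) _ _ this] show ?thesis
          unfolding eq using psubset.prems by auto
      qed
    qed
    show ?case
    proof (cases "2 \<le> card S")
      case False
      moreover have "card S \<noteq> 0" using psubset.hyps psubset.prems by simp
      ultimately have "card S = 1" by simp
      then obtain v where "S = {v}" by (auto simp: card_1_singleton_iff)
      then have "bidirectional_complete (induced G S)"
        by (auto simp: bidirectional_complete_iff induced_def loopless)
      then show ?thesis by (rule directed_co_wqt.complete)
    next
      case True
      with psubset.prems(1) show ?thesis
      proof (cases rule: uniform_cut)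
        case (1 A)
        then show ?thesis by (intro step[of A]) (auto simp: cutset_def wqt_cut_def bid_def)
      next
        case (2 A0)
        obtain A where "cutset non S A" "complete_on (parcs G) A"
          using non_cut_complete_part[OF psubset.hyps 2] .
        then show ?thesis
          by (intro step[of A] disjI2) (auto simp: cutset_def wqt_cut_def non_def)
      next
        case (3 A0)
        obtain A where "cutset arrow S A" "complete_on (parcs G) A \<or> complete_on (parcs G) (S - A)"
          using order_cut_complete_part[OF psubset.hyps psubset.prems(1) 3] .
        then show ?thesis
          by (intro step[of A] disjI1) (auto simp: cutset_def wqt_cut_def arrow_def)
      qed
    qed
  qed
qed

end

theorem theorem4p35:
  fixes G :: "'a pair_pre_digraph"
  assumes "nonempty_digraph G"
  shows "directed_co_wqt G \<longleftrightarrow>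
    G \<in> Free ({D1, D2, D3, D4, D5, D6, D7, D8} \<union> complement ` {Q1, Q2, Q3, Q4, Q5, Q6, Q7})"
    (is "_ \<longleftrightarrow> G \<in> Free ?F")
proof -
  have G: "pair_digraph G" "pverts G \<noteq> {}" using assms by (auto simp: nonempty_digraph_def)
  have wf: "pair_wf_digraph X" if "X \<in> ?F" for X using that obstructions_wf by auto
  have "G \<in> Free ?F \<longleftrightarrow> (\<forall>X\<in>?F. \<not> embeds X G)"
    using assms wf by (rule Free_iff_not_embeds)
  also have "\<dots> \<longleftrightarrow> directed_co_wqt G"
  proof
    assume "\<forall>X\<in>?F. \<not> embeds X G"
    then interpret obstruction_free G
      using G(1) by (intro obstruction_free.intro obstruction_free_axioms.intro) auto
    \<comment> \<open>Well-formedness puts all arcs inside the vertex set, so nothing is lost by the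
      restriction.\<close>
    have "induced G (pverts G) = G"
      using wellformed' by (intro pair_pre_digraph.equality) (auto simp: induced_def)
    with directed_co_wqt_induced[of "pverts G"] G(2) show "directed_co_wqt G" by simp
  next
    assume wqt: "directed_co_wqt G"
    show "\<forall>X\<in>?F. \<not> embeds X G"
    proof
      fix X assume "X \<in> ?F"
      then have "\<not> wqt_separable X" "\<not> complete_on (parcs X) (pverts X)"
        using obstructions_not_separable obstructions_not_complete by auto
      then show "\<not> embeds X G" by (rule directed_co_wqt_not_embeds[OF wqt])
    qed
  qed
  finally show ?thesis by simp
qed

end
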